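(* Let $A$ be a finite alphabet and let $F:A^{\mathbb N}\to A^{\mathbb N}$ be a dill map with diameter $\theta\geq 1$ and local rule $f:A^\theta\to A^+$. The following statements are equivalent: (1) $F$ induces a well-defined map on the Weyl space, i.e. for all $x,y\in A^{\mathbb N}$, $W_H(x,y)=0$ implies $W_H(F(x),F(y))=0$; (2) $F$ is $\frac{\theta\,\Delta_f}{\|f\|^-}$-Lipschitz with respect to $W_H$, i.e. $W_H(F(x),F(y))\le \frac{\theta\,\Delta_f}{\|f\|^-}\,W_H(x,y)$ for all $x,y\in A^{\mathbb N}$; (3) $F$ is either constant or uniform.
   Context: For a finite word $u=u_0u_1\cdots u_{|u|-1}$ and integers $a\le b$, write $u_{[a,b)}=u_a\cdots u_{b-1}$ (similarly for $x\in A^{\mathbb N}$). $A^+$ is the set of nonempty finite words. The Hamming distance of two words $u,v$ of the same length is $d_H(u,v)=|\{i: u_i\neq v_i\}|$. The Weyl pseudo-metric on $A^{\mathbb N}$ is $W_H(x,y)=\limsup_{\ell\to\infty}\max_{k\in\mathbb N}\frac{d_H(x_{[k,k+\ell)},y_{[k,k+\ell)})}{\ell}$. A map $F:A^{\mathbb N}\to A^{\mathbb N}$ is a dill map with diameter $\theta\in\mathbb N\setminus\{0\}$ and local rule $f:A^\theta\to A^+$ if $F(x)=f(x_{[0,\theta)})f(x_{[1,\theta+1)})f(x_{[2,\theta+2)})\cdots$ (infinite concatenation) for all $x$. Its lower norm is $\|f\|^-=\min\{|f(u)|:u\in A^\theta\}$ and upper norm $\|f\|^+=\max\{|f(u)|:u\in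 A^\theta\}$; $F$ is uniform if $\|f\|^-=\|f\|^+$. $\Delta_f=\max\{d_H(f(u),f(v)) : u,v\in A^\theta\}$ (the maximum being taken over pairs with $|f(u)|=|f(v)|$ when $F$ is not uniform). $F$ is constant if $F(x)=F(y)$ for all $x,y$. *)

theory Defs
  imports Complex_Main "HOL-Library.Extended_Real" "HOL-Library.Omega_Words_Fun"
begin

text \<open>
  Points of $A^{\mathbb N}$ have type \<open>'a word = nat \<Rightarrow> 'a\<close>, and the factor $x_{[a,b)}$ is
  \<open>x [a \<rightarrow> b] = map x [a..<b]\<close>. Finite words are lists.
\<close>

text \<open>Only applied to lists of equal length; surplus letters of a longer second list are ignored.\<close>

definition hamming :: "'a list \<Rightarrow> 'a list \<Rightarrow> nat" where
  "hamming u v = card {i. i < length u \<and> u ! i \<noteq> v ! i}"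

text \<open>
  The maximum is over a finite set of values in $[0,1]$, so the upper limit, computed in
  \<open>ereal\<close>, is a real number in $[0,1]$ (shown below) and \<open>real_of_ereal\<close> loses nothing.
  The term for \<open>l = 0\<close> is \<open>0\<close> and does not affect the upper limit.
\<close>

definition weyl_seq :: "'a word \<Rightarrow> 'a word \<Rightarrow> nat \<Rightarrow> real" where
  "weyl_seq x y l = Max (range (\<lambda>k. real (hamming (x [k \<rightarrow> k + l]) (y [k \<rightarrow> k + l])) / real l))"

definition weyl_dist :: "'a word \<Rightarrow> 'a word \<Rightarrow> real" where
  "weyl_dist x y = real_of_ereal (limsup (\<lambda>l. ereal (weyl_seq x y l)))"

text \<open>
  Infinite concatenation of nonempty words: the first \<open>n + 1\<close> of them cover position \<open>n\<close>.
\<close>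

definition infinite_concat :: "(nat \<Rightarrow> 'a list) \<Rightarrow> 'a word" where
  "infinite_concat W = (\<lambda>n. concat (map W [0..<Suc n]) ! n)"

definition dill_map :: "nat \<Rightarrow> ('a list \<Rightarrow> 'a list) \<Rightarrow> ('a word \<Rightarrow> 'a word) \<Rightarrow> bool" where
  "dill_map \<theta> f F \<longleftrightarrow>
     \<theta> > 0 \<and> (\<forall>u. length u = \<theta> \<longrightarrow> f u \<noteq> []) \<and>
     (\<forall>x. F x = infinite_concat (\<lambda>i. f (x [i \<rightarrow> i + \<theta>])))"

definition lower_norm :: "nat \<Rightarrow> ('a::finite list \<Rightarrow> 'a list) \<Rightarrow> nat" where
  "lower_norm \<theta> f = Min {length (f u) | u. length u = \<theta>}"

definition upper_norm :: "nat \<Rightarrow> ('a::finite list \<Rightarrow> 'a list) \<Rightarrow> nat" where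
  "upper_norm \<theta> f = Max {length (f u) | u. length u = \<theta>}"

definition uniform_rule :: "nat \<Rightarrow> ('a::finite list \<Rightarrow> 'a list) \<Rightarrow> bool" where
  "uniform_rule \<theta> f \<longleftrightarrow> lower_norm \<theta> f = upper_norm \<theta> f"

text \<open>In the uniform case the condition on the lengths of the images holds for all pairs.\<close>

definition max_hamming :: "nat \<Rightarrow> ('a::finite list \<Rightarrow> 'a list) \<Rightarrow> nat" where
  "max_hamming \<theta> f =
     Max {hamming (f u) (f v) | u v. length u = \<theta> \<and> length v = \<theta> \<and> length (f u) = length (f v)}"


lemma hamming_le_length: "hamming u v \<le> length u"
proof -
  have "hamming u v \<le> card {..<length u}"
    unfolding hamming_def by (intro card_mono) auto
  then show ?thesis by simp
qed

lemma finite_weyl_range: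
  "finite (range (\<lambda>k. real (hamming (x [k \<rightarrow> k + l]) (y [k \<rightarrow> k + l])) / real l))"
proof (rule finite_subset)
  have "hamming (x [k \<rightarrow> k + l]) (y [k \<rightarrow> k + l]) \<le> l" for k
    using hamming_le_length[of "x [k \<rightarrow> k + l]" "y [k \<rightarrow> k + l]"] by (simp add: subsequence_def)
  then show "range (\<lambda>k. real (hamming (x [k \<rightarrow> k + l]) (y [k \<rightarrow> k + l])) / real l)
        \<subseteq> (\<lambda>m. real m / real l) ` {..l}"
    by auto
qed simp

lemma weyl_seq_bounds: "0 \<le> weyl_seq x y l" "weyl_seq x y l \<le> 1"
proof -
  have "weyl_seq x y l \<in> range (\<lambda>k. real (hamming (x [k \<rightarrow> k + l]) (y [k \<rightarrow> k + l])) / real l)"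
    unfolding weyl_seq_def by (rule Max_in[OF finite_weyl_range]) simp
  then obtain k where
    k: "weyl_seq x y l = real (hamming (x [k \<rightarrow> k + l]) (y [k \<rightarrow> k + l])) / real l"
    by blast
  have "hamming (x [k \<rightarrow> k + l]) (y [k \<rightarrow> k + l]) \<le> l"
    using hamming_le_length[of "x [k \<rightarrow> k + l]" "y [k \<rightarrow> k + l]"] by (simp add: subsequence_def)
  then show "0 \<le> weyl_seq x y l" "weyl_seq x y l \<le> 1"
    unfolding k by (auto simp: divide_le_eq_1)
qed

lemma ereal_weyl_dist: "ereal (weyl_dist x y) = limsup (\<lambda>l. ereal (weyl_seq x y l))"
  and weyl_dist_nonneg: "0 \<le> weyl_dist x y"
  and weyl_dist_le_1: "weyl_dist x y \<le> 1"
proof -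
  let ?L = "limsup (\<lambda>l. ereal (weyl_seq x y l))"
  have "0 \<le> ?L"
    by (rule le_Limsup) (simp_all add: weyl_seq_bounds)
  moreover have "?L \<le> 1"
    by (rule Limsup_bounded) (simp_all add: weyl_seq_bounds)
  ultimately show "ereal (weyl_dist x y) = ?L" "0 \<le> weyl_dist x y" "weyl_dist x y \<le> 1"
    unfolding weyl_dist_def by (cases ?L; simp; fail)+
qed

lemma length_concat_ge:
  assumes "\<And>i. W i \<noteq> []"
  shows "n \<le> length (concat (map W [0..<n]))"
proof (induction n)
  case (Suc n)
  have "0 < length (W n)" using assms[of n] unfolding length_greater_0_conv .
  with Suc show ?case by (simp del: length_greater_0_conv)
qed simp

lemma concat_map_upt_nth_mono:
  assumes "m \<le> n" "j < length (concat (map W [0..<m]))"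
  shows "concat (map W [0..<n]) ! j = concat (map W [0..<m]) ! j"
proof -
  have "[0..<n] = [0..<m] @ [m..<n]"
    using assms(1) upt_add_eq_append[of 0 m "n - m"] by simp
  then show ?thesis using assms(2) by (simp add: nth_append)
qed

text \<open>Every finite concatenation is a prefix of the infinite one.\<close>

lemma infinite_concat_prefix:
  assumes "\<And>i. W i \<noteq> []"
  shows "prefix (length (concat (map W [0..<n]))) (infinite_concat W) = concat (map W [0..<n])"
proof (rule nth_equalityI)
  show "length (prefix (length (concat (map W [0..<n]))) (infinite_concat W))
      = length (concat (map W [0..<n]))"
    by (simp add: subsequence_def)
next
  fix j
  assume "j < length (prefix (length (concat (map W [0..<n]))) (infinite_concat W))"
  then have j: "j < length (concat (map W [0..<n]))"
    by (simp add: subsequence_def)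
  have j': "j < length (concat (map W [0..<Suc j]))"
    using length_concat_ge[OF assms, where n = "Suc j"] by (rule Suc_le_lessD)
  have "concat (map W [0..<Suc j]) ! j = concat (map W [0..<n]) ! j"
  proof (cases "n \<le> Suc j")
    case True
    then show ?thesis using j by (rule concat_map_upt_nth_mono)
  next
    case False
    then have "Suc j \<le> n" by simp
    from concat_map_upt_nth_mono[OF this j'] show ?thesis by (rule sym)
  qed
  then show "prefix (length (concat (map W [0..<n]))) (infinite_concat W) ! j
      = concat (map W [0..<n]) ! j"
    using j by (simp add: subsequence_def infinite_concat_def del: upt_Suc)
qed

lemma finite_words: "finite {u :: 'a::finite list. length u = n}"
  using finite_lists_length_eq[of "UNIV :: 'a set" n] by simp

lemma uniform_rule_iff:
  fixes f :: "'a::finite list \<Rightarrow> 'a list"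
  shows "uniform_rule \<theta> f \<longleftrightarrow>
    (\<forall>u v. length u = \<theta> \<longrightarrow> length v = \<theta> \<longrightarrow> length (f u) = length (f v))"
proof -
  let ?S = "{length (f u) | u. length u = \<theta>}"
  have fin: "finite ?S" by (rule finite_image_set[OF finite_words])
  have ne: "?S \<noteq> {}" using Ex_list_of_length[of \<theta>] by blast
  show ?thesis
  proof
    assume "uniform_rule \<theta> f"
    then have eq: "Min ?S = Max ?S"
      by (simp add: uniform_rule_def lower_norm_def upper_norm_def)
    have "length (f u) = Max ?S" if "length u = \<theta>" for u
    proof (rule antisym)
      show "length (f u) \<le> Max ?S" using that by (intro Max_ge[OF fin]) blast
      show "Max ?S \<le> length (f u)" unfolding eq[symmetric] using that by (intro Min_le[OF fin]) blast
    qed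
    then show "\<forall>u v. length u = \<theta> \<longrightarrow> length v = \<theta> \<longrightarrow> length (f u) = length (f v)" by simp
  next
    assume *: "\<forall>u v. length u = \<theta> \<longrightarrow> length v = \<theta> \<longrightarrow> length (f u) = length (f v)"
    obtain u where u: "Min ?S = length (f u)" "length u = \<theta>" using Min_in[OF fin ne] by blast
    obtain v where v: "Max ?S = length (f v)" "length v = \<theta>" using Max_in[OF fin ne] by blast
    have "length (f u) = length (f v)" using * u(2) v(2) by blast
    then have "Min ?S = Max ?S" by (rule trans[OF u(1) trans[OF _ v(1)[symmetric]]])
    then show "uniform_rule \<theta> f"
      by (simp add: uniform_rule_def lower_norm_def upper_norm_def)
  qed
qed

end

theory Submission
  imports Defs
begin

text \<open>
  For the main implication, let the rule be non-uniform and let \<open>F\<close> respect Weyl equivalence.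
  Over every tail \<open>z\<close> there are two words of equal length whose images, in front of \<open>F z\<close>, have
  different lengths. So \<open>F z\<close> is Weyl equivalent to one of its proper shifts, and, the length
  differences being bounded, to its shift by a number \<open>t\<close> independent of \<open>z\<close>. For periodic \<open>z\<close>
  the word \<open>F z\<close> is periodic, and Weyl equivalent periodic words are equal, so \<open>t\<close> is a period of
  \<open>F z\<close>; by approximation this holds for every \<open>z\<close>. Hence \<open>F x = F y\<close> as soon as \<open>x\<close> and \<open>y\<close> have
  a common tail, whereas \<open>F x\<close>, having period \<open>t\<close>, is determined by a prefix of \<open>x\<close> of bounded
  length. The two together make \<open>F\<close> constant.
\<close>

section \<open>The Weyl pseudo-metric\<close>

text \<open>The Hamming distance of two windows, recorded through absolute positions so that windows
  can be shifted and covered as sets.\<close>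

definition mismatches :: "'a word \<Rightarrow> 'a word \<Rightarrow> nat \<Rightarrow> nat \<Rightarrow> nat" where
  "mismatches x y k l = card {i \<in> {k..<k + l}. x i \<noteq> y i}"

lemma card_Collect_shift:
  fixes k l s :: nat
  shows "card {i \<in> {s + k..<s + k + l}. P i} = card {i \<in> {k..<k + l}. P (s + i)}"
proof -
  have eq: "{s + k..<s + k + l} = (+) s ` {k..<k + l}"
    by (simp add: ac_simps)
  have "{i \<in> {s + k..<s + k + l}. P i} = (+) s ` {i \<in> {k..<k + l}. P (s + i)}"
    unfolding eq by blast
  then show ?thesis by (simp add: card_image)
qed

lemma hamming_subsequence: "hamming (x [k \<rightarrow> k + l]) (y [k \<rightarrow> k + l]) = mismatches x y k l"
proof -
  have "mismatches x y k l = card {i \<in> {0..<0 + l}. x (k + i) \<noteq> y (k + i)}"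
    using card_Collect_shift[of k 0 l "\<lambda>i. x i \<noteq> y i"] by (simp add: mismatches_def)
  also have "{i \<in> {0..<0 + l}. x (k + i) \<noteq> y (k + i)} =
      {i. i < length (x [k \<rightarrow> k + l]) \<and> x [k \<rightarrow> k + l] ! i \<noteq> y [k \<rightarrow> k + l] ! i}"
    by (auto simp: subsequence_def)
  finally show ?thesis by (simp add: hamming_def)
qed

lemma weyl_seq_le_iff:
  assumes "l > 0"
  shows "weyl_seq x y l \<le> c \<longleftrightarrow> (\<forall>k. real (mismatches x y k l) \<le> c * real l)"
proof -
  have "finite (range (\<lambda>k. real (mismatches x y k l) / real l))"
    using finite_weyl_range[of x l y] by (simp add: hamming_subsequence)
  then show ?thesis
    using assms by (auto simp: weyl_seq_def hamming_subsequence divide_le_eq)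
qed

text \<open>Together with \<open>weyl_dist_leI\<close> this replaces the upper limit by counting
  bounds that hold for all windows of a large length at once.\<close>

lemma eventually_mismatches_le:
  assumes "weyl_dist x y < c"
  shows "\<forall>\<^sub>F l in sequentially. \<forall>k. real (mismatches x y k l) \<le> c * real l"
proof -
  have "limsup (\<lambda>l. ereal (weyl_seq x y l)) < ereal c"
    using assms by (simp flip: ereal_weyl_dist)
  then have "\<forall>\<^sub>F l in sequentially. weyl_seq x y l < c"
    by (auto dest: Limsup_lessD)
  with eventually_gt_at_top[of 0] show ?thesis
    by eventually_elim (simp flip: weyl_seq_le_iff)
qed

lemma weyl_dist_leI:
  assumes "\<And>e. e > c \<Longrightarrow> \<forall>\<^sub>F l in sequentially. \<forall>k. real (mismatches x y k l) \<le> e * real l"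
  shows "weyl_dist x y \<le> c"
proof (rule dense_ge)
  fix e assume "c < e"
  from assms[OF this] eventually_gt_at_top[of 0]
  have "\<forall>\<^sub>F l in sequentially. ereal (weyl_seq x y l) \<le> ereal e"
    by eventually_elim (simp add: weyl_seq_le_iff)
  then have "limsup (\<lambda>l. ereal (weyl_seq x y l)) \<le> ereal e"
    by (rule Limsup_bounded)
  then show "weyl_dist x y \<le> e" by (simp flip: ereal_weyl_dist)
qed

lemma weyl_dist_triangle: "weyl_dist x z \<le> weyl_dist x y + weyl_dist y z"
proof (rule weyl_dist_leI)
  fix e assume e: "weyl_dist x y + weyl_dist y z < e"
  \<comment> \<open>Half of the slack goes to each of the two distances.\<close>
  define d where "d = (e - weyl_dist x y - weyl_dist y z) / 2"
  have le: "mismatches x z k l \<le> mismatches x y k l + mismatches y z k l" for k l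
  proof -
    have "mismatches x z k l \<le>
        card ({i \<in> {k..<k + l}. x i \<noteq> y i} \<union> {i \<in> {k..<k + l}. y i \<noteq> z i})"
      unfolding mismatches_def by (intro card_mono) auto
    then show ?thesis unfolding mismatches_def using card_Un_le le_trans by blast
  qed
  have "weyl_dist x y < weyl_dist x y + d" "weyl_dist y z < weyl_dist y z + d"
    using e by (auto simp: d_def)
  then have "\<forall>\<^sub>F l in sequentially. \<forall>k. real (mismatches x y k l) \<le> (weyl_dist x y + d) * real l"
    "\<forall>\<^sub>F l in sequentially. \<forall>k. real (mismatches y z k l) \<le> (weyl_dist y z + d) * real l"
    by (simp_all add: eventually_mismatches_le)
  then show "\<forall>\<^sub>F l in sequentially. \<forall>k. real (mismatches x z k l) \<le> e * real l"
  proof eventually_elim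
    case (elim l)
    show ?case
    proof
      fix k
      have "real (mismatches x z k l) \<le> real (mismatches x y k l) + real (mismatches y z k l)"
        using le[of k l] by linarith
      also have "\<dots> \<le> (weyl_dist x y + d) * real l + (weyl_dist y z + d) * real l"
        using elim by (intro add_mono) auto
      also have "\<dots> = e * real l" by (simp add: d_def field_simps)
      finally show "real (mismatches x z k l) \<le> e * real l" .
    qed
  qed
qed

text \<open>Every window of the shifted words is a window of the original ones, starting
  \<open>s\<close> letters later.\<close>

lemma weyl_dist_suffix_le: "weyl_dist (suffix s x) (suffix s y) \<le> weyl_dist x y"
proof (rule weyl_dist_leI)
  fix e assume "weyl_dist x y < e"
  from eventually_mismatches_le[OF this]
  have ev: "\<forall>\<^sub>F l in sequentially. \<forall>k. real (mismatches x y k l) \<le> e * real l" .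
  have "mismatches (suffix s x) (suffix s y) k l = mismatches x y (s + k) l" for k l
    using card_Collect_shift[of s k l "\<lambda>i. x i \<noteq> y i"] by (simp add: mismatches_def)
  with ev show "\<forall>\<^sub>F l in sequentially.
      \<forall>k. real (mismatches (suffix s x) (suffix s y) k l) \<le> e * real l"
    by (auto elim: eventually_mono)
qed

text \<open>All mismatches lie below \<open>n\<close>, so no window has more than \<open>n\<close>
  of them, a negligible share once \<open>l\<close> reaches \<open>n / e\<close>.\<close>

lemma weyl_dist_eq_0_if_suffix_eq:
  assumes "suffix n x = suffix n y"
  shows "weyl_dist x y = 0"
proof -
  have "weyl_dist x y \<le> 0"
  proof (rule weyl_dist_leI)
    fix e :: real assume "0 < e"
    have eq: "x i = y i" if "i \<ge> n" for i
      using fun_cong[OF assms, of "i - n"] that by simp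
    have le: "mismatches x y k l \<le> n" for k l
    proof -
      have "mismatches x y k l \<le> card {..<n}"
        unfolding mismatches_def
        by (intro card_mono) (auto simp: not_le[symmetric] dest: eq)
      then show ?thesis by simp
    qed
    have "\<forall>\<^sub>F l in sequentially. real n / e \<le> real l"
      using eventually_ge_at_top[of "nat \<lceil>real n / e\<rceil>"] by eventually_elim linarith
    then show "\<forall>\<^sub>F l in sequentially. \<forall>k. real (mismatches x y k l) \<le> e * real l"
    proof eventually_elim
      case (elim l)
      then have "real n \<le> e * real l" using \<open>0 < e\<close> by (simp add: field_simps)
      then show ?case using le order_trans of_nat_mono by blast
    qed
  qed
  with weyl_dist_nonneg[of x y] show ?thesis by simp
qed

section \<open>Shifts and periodic words\<close>

lemma weyl_dist_suffix_mult:
  assumes "weyl_dist x (suffix s x) = 0"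
  shows "weyl_dist x (suffix (n * s) x) = 0"
proof (induction n)
  case 0
  show ?case using weyl_dist_eq_0_if_suffix_eq[of 0 x x] by simp
next
  case (Suc n)
  have "suffix s (suffix (n * s) x) = suffix (Suc n * s) x"
    by (simp only: suffix_suffix mult_Suc add.commute)
  then have "weyl_dist (suffix s x) (suffix (Suc n * s) x) \<le> 0"
    using weyl_dist_suffix_le[of s x "suffix (n * s) x"] Suc by (simp only:)
  then show ?case
    using weyl_dist_triangle[of x "suffix (Suc n * s) x" "suffix s x"] assms
      weyl_dist_nonneg[of x "suffix (Suc n * s) x"] by linarith
qed

lemma suffix_period_mult:
  assumes "suffix m x = x"
  shows "suffix (n * m) x = x"
proof (induction n)
  case (Suc n)
  have "suffix (Suc n * m) x = suffix (n * m) (suffix m x)" by simp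
  then show ?case using Suc assms by simp
qed simp

text \<open>A single mismatch recurs in every period and therefore has density at least
  \<open>1 / m\<close>.\<close>

lemma periodic_eq_if_weyl_dist_eq_0:
  assumes x: "suffix m x = x" and y: "suffix m y = y" and "m > 0"
    and "weyl_dist x y = 0"
  shows "x = y"
proof (rule ccontr)
  assume "x \<noteq> y"
  then obtain j where j: "x j \<noteq> y j" by auto
  \<comment> \<open>Half of the density \<open>1 / m\<close>: the \<open>n\<close> mismatches found
    in \<open>n * m\<close> letters exceed \<open>c\<close> times that length.\<close>
  define c where "c = 1 / (2 * real m)"
  have "weyl_dist x y < c" using assms by (simp add: c_def)
  from eventually_mismatches_le[OF this] obtain N where
    N: "\<And>l k. l \<ge> N \<Longrightarrow> real (mismatches x y k l) \<le> c * real l"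
    by (auto simp: eventually_sequentially)
  define n where "n = Suc N"
  have "n = card ((\<lambda>i. j + i * m) ` {..<n})"
    using \<open>m > 0\<close> by (subst card_image) (auto simp: inj_on_def)
  also have "\<dots> \<le> mismatches x y j (n * m)"
    unfolding mismatches_def
  proof (intro card_mono subsetI)
    fix i assume "i \<in> (\<lambda>i. j + i * m) ` {..<n}"
    then obtain d where d: "d < n" "i = d * m + j" by auto
    have "x i = x j" "y i = y j"
      using fun_cong[OF suffix_period_mult[OF x, of d], of j]
        fun_cong[OF suffix_period_mult[OF y, of d], of j] d by simp_all
    then show "i \<in> {i \<in> {j..<j + n * m}. x i \<noteq> y i}"
      using j d \<open>m > 0\<close> by simp
  qed simp
  finally have "real n \<le> real (mismatches x y j (n * m))" by simp
  also have "N \<le> n * m" using \<open>m > 0\<close> by (cases m) (auto simp: n_def)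
  then have "real (mismatches x y j (n * m)) \<le> c * real (n * m)" by (rule N)
  also have "\<dots> = real n / 2" using \<open>m > 0\<close> by (simp add: c_def)
  finally show False by (simp add: n_def)
qed

section \<open>Dill maps\<close>

lemma infinite_concat_nth:
  assumes "\<And>i. W i \<noteq> []" "j < length (concat (map W [0..<n]))"
  shows "infinite_concat W j = concat (map W [0..<n]) ! j"
  using arg_cong[OF infinite_concat_prefix[of W n, OF assms(1)], of "\<lambda>u. u ! j"] assms(2)
  by (simp add: subsequence_def)

text \<open>The first \<open>n + Suc j\<close> blocks split after block \<open>n\<close>; the
  remaining \<open>Suc j\<close> blocks are nonempty and thus already cover position
  \<open>j\<close>.\<close>

lemma suffix_infinite_concat:
  assumes "\<And>i. W i \<noteq> []"
  shows "suffix (length (concat (map W [0..<n]))) (infinite_concat W) =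
    infinite_concat (\<lambda>i. W (n + i))"
proof
  fix j
  define V where "V = (\<lambda>i. W (n + i))"
  have split: "concat (map W [0..<n + Suc j]) =
      concat (map W [0..<n]) @ concat (map V [0..<Suc j])"
  proof -
    have "[0..<n + Suc j] = [0..<n] @ map (\<lambda>i. i + n) [0..<Suc j]"
      using upt_add_eq_append[of 0 n "Suc j"] map_add_upt[of n "Suc j"] by (simp add: add.commute)
    then show ?thesis by (simp add: V_def comp_def add.commute del: upt_Suc)
  qed
  have j: "j < length (concat (map V [0..<Suc j]))"
    using length_concat_ge[of V "Suc j"] assms by (simp add: V_def Suc_le_eq del: upt_Suc)
  have "infinite_concat W (length (concat (map W [0..<n])) + j) = concat (map V [0..<Suc j]) ! j"
    using infinite_concat_nth[of W "length (concat (map W [0..<n])) + j" "n + Suc j"] assms j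
    unfolding split by (simp add: nth_append)
  also have "\<dots> = infinite_concat V j"
    by (simp add: infinite_concat_def)
  finally show "suffix (length (concat (map W [0..<n]))) (infinite_concat W) j =
      infinite_concat (\<lambda>i. W (n + i)) j"
    by (simp add: V_def)
qed

text \<open>The position at which the image of the window at \<open>n\<close> begins in the
  concatenation of all the images.\<close>

definition image_length :: "nat \<Rightarrow> ('a list \<Rightarrow> 'a list) \<Rightarrow> 'a word \<Rightarrow> nat \<Rightarrow> nat" where
  "image_length \<theta> f x n = (\<Sum>i<n. length (f (x [i \<rightarrow> i + \<theta>])))"

lemma length_concat_image:
  "length (concat (map (\<lambda>i. f (x [i \<rightarrow> i + \<theta>])) [0..<n])) = image_length \<theta> f x n"
  by (induction n) (simp_all add: image_length_def)

lemma subsequence_suffix: "subsequence (suffix k x) i j = x [k + i \<rightarrow> k + j]"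
  by (rule nth_equalityI) (simp_all add: subsequence_def add.assoc)

lemma image_length_Suc:
  "image_length \<theta> f x (Suc n) = length (f (x [0 \<rightarrow> \<theta>])) + image_length \<theta> f (suffix 1 x) n"
  unfolding image_length_def by (subst sum.lessThan_Suc_shift) (simp add: subsequence_suffix)

lemma image_length_le:
  fixes f :: "'a::finite list \<Rightarrow> 'a list"
  shows "image_length \<theta> f x n \<le> n * upper_norm \<theta> f"
proof -
  have "length (f (x [i \<rightarrow> i + \<theta>])) \<le> upper_norm \<theta> f" for i
    unfolding upper_norm_def
    by (intro Max_ge finite_image_set[OF finite_words]) (auto simp: subsequence_def)
  then have "image_length \<theta> f x n \<le> (\<Sum>i<n. upper_norm \<theta> f)"
    unfolding image_length_def by (intro sum_mono) auto
  then show ?thesis by simp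
qed

text \<open>
  Dropping the first letter of two words \<open>u z\<close> and \<open>v z\<close> changes the difference of the image lengths
  by the difference for \<open>u\<close> and \<open>v\<close>, so it cannot vanish both before and after.
\<close>

lemma image_length_neqE:
  fixes f :: "'a::finite list \<Rightarrow> 'a list"
  assumes "\<not> uniform_rule \<theta> f" "\<theta> > 0"
  obtains x y n where "n \<le> \<theta>" "suffix n x = z" "suffix n y = z"
    "image_length \<theta> f x n \<noteq> image_length \<theta> f y n"
proof -
  obtain u v where uv: "length u = \<theta>" "length v = \<theta>" "length (f u) \<noteq> length (f v)"
    using assms(1) by (auto simp: uniform_rule_iff)
  obtain m where m: "\<theta> = Suc m" using assms(2) by (cases \<theta>) auto
  define x where "x = u \<frown> z"
  define y where "y = v \<frown> z"
  have tail: "suffix \<theta> x = z" "suffix \<theta> y = z"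
    using uv by (auto simp: x_def y_def)
  have "x [0 \<rightarrow> \<theta>] = u" "y [0 \<rightarrow> \<theta>] = v"
    using uv by (auto simp: x_def y_def)
  with uv have "image_length \<theta> f x (Suc m) \<noteq> image_length \<theta> f y (Suc m) \<or>
      image_length \<theta> f (suffix 1 x) m \<noteq> image_length \<theta> f (suffix 1 y) m"
    by (auto simp: image_length_Suc)
  then show ?thesis
  proof
    assume "image_length \<theta> f x (Suc m) \<noteq> image_length \<theta> f y (Suc m)"
    then show ?thesis using that[of \<theta> x y] tail m by simp
  next
    assume "image_length \<theta> f (suffix 1 x) m \<noteq> image_length \<theta> f (suffix 1 y) m"
    then show ?thesis using that[of m "suffix 1 x" "suffix 1 y"] tail m by simp
  qed
qed

context
  fixes \<theta> :: nat and f :: "'a::finite list \<Rightarrow> 'a list" and F :: "'a word \<Rightarrow> 'a word"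
  assumes dill: "dill_map \<theta> f F"
begin

lemma diameter_pos: "\<theta> > 0"
  using dill by (simp add: dill_map_def)

lemma rule_subsequence_nonempty: "f (x [i \<rightarrow> i + \<theta>]) \<noteq> []"
  using dill by (simp add: dill_map_def subsequence_def)

lemma dill_map_eq: "F x = infinite_concat (\<lambda>i. f (x [i \<rightarrow> i + \<theta>]))"
  using dill by (simp add: dill_map_def)

text \<open>The images of the windows from \<open>n\<close> on are those of the shifted word. Thus
  \<open>F\<close> turns shifts into shifts, by an amount that may depend on
  \<open>x\<close>.\<close>

lemma suffix_dill_map: "suffix (image_length \<theta> f x n) (F x) = F (suffix n x)"
proof -
  have "suffix (image_length \<theta> f x n) (F x) = infinite_concat (\<lambda>i. f (x [n + i \<rightarrow> n + i + \<theta>]))"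
    using suffix_infinite_concat[of "\<lambda>i. f (x [i \<rightarrow> i + \<theta>])" n]
    by (simp only: length_concat_image dill_map_eq rule_subsequence_nonempty not_False_eq_True)
  then show ?thesis by (simp add: dill_map_eq subsequence_suffix add.assoc)
qed

lemma dill_map_nth: "d < length (f (x [i \<rightarrow> i + \<theta>])) \<Longrightarrow>
    F x (image_length \<theta> f x i + d) = f (x [i \<rightarrow> i + \<theta>]) ! d"
  using infinite_concat_nth[of "\<lambda>i. f (x [i \<rightarrow> i + \<theta>])" "image_length \<theta> f x i + d" "Suc i"]
    rule_subsequence_nonempty[of x] length_concat_image[of f x \<theta> i]
  by (simp add: dill_map_eq nth_append)

text \<open>Since blocks are nonempty, the first \<open>Suc j\<close> of them cover position
  \<open>j\<close>, and their windows stay below \<open>n + \<theta>\<close>.\<close>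

lemma dill_map_cong:
  assumes "\<And>i. i < n + \<theta> \<Longrightarrow> x i = y i" "j \<le> n"
  shows "F x j = F y j"
proof -
  have "map (\<lambda>i. f (x [i \<rightarrow> i + \<theta>])) [0..<Suc j] = map (\<lambda>i. f (y [i \<rightarrow> i + \<theta>])) [0..<Suc j]"
    using assms by (auto simp: subsequence_def intro!: arg_cong[where f = f] simp del: upt_Suc)
  then show ?thesis by (simp only: dill_map_eq infinite_concat_def)
qed

lemma image_length_ge: "n \<le> image_length \<theta> f x n"
  using length_concat_ge[of "\<lambda>i. f (x [i \<rightarrow> i + \<theta>])" n] rule_subsequence_nonempty
  by (simp add: length_concat_image)

section \<open>Dill maps on the Weyl space\<close>

text \<open>Double counting: a letter lies in at most \<open>\<theta>\<close> windows, and the two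
  images of a window differ in at most \<open>\<Delta>\<close> places. A stretch of \<open>l\<close>
  letters of the image comes from about \<open>l / m\<close> windows, which yields the factor
  \<open>\<theta> * \<Delta> / m\<close>.\<close>

lemma uniform_imp_lipschitz:
  assumes unif: "uniform_rule \<theta> f"
  shows "weyl_dist (F x) (F y) \<le>
    real \<theta> * real (max_hamming \<theta> f) / real (lower_norm \<theta> f) * weyl_dist x y"
proof -
  define m where "m = lower_norm \<theta> f"
  define \<Delta> where "\<Delta> = max_hamming \<theta> f"
  have len_word: "length (f u) = m" if u: "length u = \<theta>" for u
  proof -
    have "m \<in> {length (f v) | v. length v = \<theta>}"
      unfolding m_def lower_norm_def
      by (rule Min_in[OF finite_image_set[OF finite_words]]) (use u in blast)
    then obtain v where "m = length (f v)" "length v = \<theta>" by blast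
    then show ?thesis using unif u by (metis uniform_rule_iff)
  qed
  then have len: "length (f (x [i \<rightarrow> i + \<theta>])) = m" for x i
    by (simp add: subsequence_def)
  have "m > 0" using rule_subsequence_nonempty[of x 0] len[of x 0] by (cases m) auto
  have ham: "hamming (f u) (f v) \<le> \<Delta>" if "length u = \<theta>" "length v = \<theta>" for u v
  proof -
    have "{hamming (f u) (f v) | u v. length u = \<theta> \<and> length v = \<theta> \<and> length (f u) = length (f v)}
        \<subseteq> {..m}" (is "?S \<subseteq> _")
      using hamming_le_length len_word by fastforce
    then have "finite ?S" by (rule finite_subset) simp
    then show ?thesis unfolding \<Delta>_def max_hamming_def
      by (rule Max_ge) (use that len_word in auto)
  qed
  have block: "F x n = f (x [n div m \<rightarrow> n div m + \<theta>]) ! (n mod m)" for x n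
    using dill_map_nth[of "n mod m" x "n div m"] \<open>m > 0\<close> by (simp add: len image_length_def)
  have block_card: "card {n. n div m = i \<and> F x n \<noteq> F y n} \<le> \<Delta>" for i
  proof -
    have "card {n. n div m = i \<and> F x n \<noteq> F y n} \<le>
        hamming (f (x [i \<rightarrow> i + \<theta>])) (f (y [i \<rightarrow> i + \<theta>]))"
      unfolding hamming_def
    proof (rule card_inj_on_le[where f = "\<lambda>n. n mod m"])
      show "inj_on (\<lambda>n. n mod m) {n. n div m = i \<and> F x n \<noteq> F y n}"
      proof (rule inj_onI)
        fix a b assume "a \<in> {n. n div m = i \<and> F x n \<noteq> F y n}"
          "b \<in> {n. n div m = i \<and> F x n \<noteq> F y n}" "a mod m = b mod m"
        then show "a = b"
          using div_mult_mod_eq[of a m] div_mult_mod_eq[of b m] by simp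
      qed
    qed (use \<open>m > 0\<close> in \<open>auto simp: block len\<close>)
    also have "\<dots> \<le> \<Delta>" by (rule ham) (simp_all add: subsequence_def)
    finally show ?thesis .
  qed
  have fin: "finite {n. n div m = i \<and> P n}" for i P
    by (rule finite_subset[of _ "{..<Suc i * m}"])
      (use \<open>m > 0\<close> in \<open>auto simp: dividend_less_div_times\<close>)
  \<comment> \<open>A stretch of length \<open>l\<close> meets at most \<open>l div m + 2\<close>
    blocks, and the window of the last one extends less than \<open>\<theta>\<close> letters
    further. The constant excess disappears in the limit.\<close>
  have count: "mismatches (F x) (F y) k l \<le>
      \<theta> * \<Delta> * mismatches x y (k div m) (l div m + 2 + \<theta>)" for k l
  proof -
    define J where "J = {j \<in> {k div m..<k div m + (l div m + 2 + \<theta>)}. x j \<noteq> y j}"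
    \<comment> \<open>A mismatch of the arguments at \<open>j\<close>, sitting at offset
      \<open>d\<close> of a window, is charged with the block of that window. For
      \<open>j < d\<close> truncated subtraction selects block 0, which merely enlarges the union
      and obeys the same bound.\<close>
    let ?B = "\<lambda>(j, d). {n. n div m = j - d \<and> F x n \<noteq> F y n}"
    have "{n \<in> {k..<k + l}. F x n \<noteq> F y n} \<subseteq> (\<Union>p \<in> J \<times> {..<\<theta>}. ?B p)"
    proof
      fix n assume "n \<in> {n \<in> {k..<k + l}. F x n \<noteq> F y n}"
      then have n: "k \<le> n" "n < k + l" "F x n \<noteq> F y n" by auto
      then have "x [n div m \<rightarrow> n div m + \<theta>] \<noteq> y [n div m \<rightarrow> n div m + \<theta>]"
        by (auto simp: block)
      then obtain d where d: "d < \<theta>" "x (n div m + d) \<noteq> y (n div m + d)"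
        by (auto simp: subsequence_def) (metis add_diff_inverse_nat leD nat_add_left_cancel_less)
      have "n div m \<le> (k + l) div m" using n by (intro div_le_mono) simp
      also have "(k + l) div m \<le> k div m + l div m + 1"
      proof -
        have "k mod m + l mod m < 2 * m" using \<open>m > 0\<close> by (simp add: add_strict_mono mult_2)
        then have "(k mod m + l mod m) div m < 2" by (rule less_mult_imp_div_less)
        then show ?thesis by (simp add: div_add1_eq[of k l m])
      qed
      finally have "n div m + d \<in> J"
        using d n(1) div_le_mono[OF n(1), of m] by (simp add: J_def)
      then show "n \<in> (\<Union>p \<in> J \<times> {..<\<theta>}. ?B p)"
        using d(1) n(3) by (intro UN_I[of "(n div m + d, d)"]) auto
    qed
    then have "mismatches (F x) (F y) k l \<le> card (\<Union>p \<in> J \<times> {..<\<theta>}. ?B p)"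
      unfolding mismatches_def
      by (rule card_mono[rotated]) (auto simp: J_def intro!: fin)
    also have "\<dots> \<le> (\<Sum>p \<in> J \<times> {..<\<theta>}. card (?B p))"
      by (rule card_UN_le) (simp add: J_def)
    also have "\<dots> \<le> (\<Sum>p \<in> J \<times> {..<\<theta>}. \<Delta>)"
      by (rule sum_mono) (auto intro: block_card)
    also have "\<dots> = \<theta> * \<Delta> * mismatches x y (k div m) (l div m + 2 + \<theta>)"
      by (simp add: J_def mismatches_def card_cartesian_product)
    finally show ?thesis .
  qed
  define K where "K = real \<theta> * real \<Delta> / real m"
  have "K \<ge> 0" by (simp add: K_def)
  have "weyl_dist (F x) (F y) \<le> K * weyl_dist x y"
  proof (rule weyl_dist_leI)
    fix e assume e: "K * weyl_dist x y < e"
    \<comment> \<open>Just above the distance, with \<open>K * c\<close> still below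
      \<open>e\<close>; \<open>K + 1\<close> keeps the divisor positive when \<open>K\<close> is
      0.\<close>
    define c where "c = weyl_dist x y + (e - K * weyl_dist x y) / (2 * (K + 1))"
    have c: "weyl_dist x y < c" using e \<open>K \<ge> 0\<close> by (simp add: c_def)
    have "K * c = K * weyl_dist x y + K / (K + 1) * ((e - K * weyl_dist x y) / 2)"
      using \<open>K \<ge> 0\<close> by (simp add: c_def field_simps)
    also have "\<dots> \<le> K * weyl_dist x y + 1 * ((e - K * weyl_dist x y) / 2)"
      using e \<open>K \<ge> 0\<close> by (intro add_left_mono mult_right_mono) auto
    also have "\<dots> < e" using e by (simp add: field_simps)
    finally have Kc: "K * c < e" .
    have "c \<ge> 0" using c weyl_dist_nonneg[of x y] by simp
    from eventually_mismatches_le[OF c] obtain N where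
      N: "\<And>l k. l \<ge> N \<Longrightarrow> real (mismatches x y k l) \<le> c * real l"
      by (auto simp: eventually_sequentially)
    \<comment> \<open>From this length on, the gap \<open>e - K * c\<close> absorbs the error caused
      by the \<open>2 + \<theta>\<close> extra letters.\<close>
    define M where "M = K * c * real m * real (2 + \<theta>) / (e - K * c)"
    have "\<forall>\<^sub>F l in sequentially. M \<le> real l"
      using eventually_ge_at_top[of "nat \<lceil>M\<rceil>"] by eventually_elim linarith
    then show "\<forall>\<^sub>F l in sequentially. \<forall>k. real (mismatches (F x) (F y) k l) \<le> e * real l"
      using eventually_ge_at_top[of "N * m"]
    proof eventually_elim
      case (elim l)
      have "l div m \<ge> N" using elim(2) \<open>m > 0\<close> by (simp add: less_eq_div_iff_mult_less_eq)
      then have Nl: "l div m + 2 + \<theta> \<ge> N" by simp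
      show ?case
      proof
        fix k
        have "real (mismatches (F x) (F y) k l) \<le>
            real (\<theta> * \<Delta>) * real (mismatches x y (k div m) (l div m + 2 + \<theta>))"
          using count[of k l] by (metis of_nat_mono of_nat_mult)
        also have "\<dots> \<le> real (\<theta> * \<Delta>) * (c * real (l div m + 2 + \<theta>))"
          by (intro mult_left_mono N Nl) simp
        also have "\<dots> = K * c * (real m * real (l div m) + real m * real (2 + \<theta>))"
          using \<open>m > 0\<close> by (simp add: K_def field_simps)
        also have "\<dots> \<le> K * c * (real l + real m * real (2 + \<theta>))"
          using \<open>K \<ge> 0\<close> \<open>c \<ge> 0\<close>
          by (intro mult_left_mono add_right_mono)
            (auto simp flip: of_nat_mult simp: mult.commute)
        also have "\<dots> = K * c * real l + M * (e - K * c)"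
          using Kc by (simp add: M_def field_simps)
        also have "\<dots> \<le> K * c * real l + real l * (e - K * c)"
          using Kc elim(1) by (intro add_left_mono mult_right_mono) auto
        also have "\<dots> = e * real l" by (simp add: field_simps)
        finally show "real (mismatches (F x) (F y) k l) \<le> e * real l" .
      qed
    qed
  qed
  then show ?thesis by (simp add: K_def m_def \<Delta>_def)
qed

section \<open>Non-uniform rules compatible with Weyl equivalence\<close>

lemma weyl_compatible_imp_constant:
  assumes comp: "\<And>x y. weyl_dist x y = 0 \<Longrightarrow> weyl_dist (F x) (F y) = 0"
    and nonunif: "\<not> uniform_rule \<theta> f"
  shows "F x = F y"
proof -
  \<comment> \<open>A common multiple of all the length differences \<open>s\<close> that can occur
    below.\<close>
  define t :: nat where "t = fact (\<theta> * upper_norm \<theta> f)"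
  have "t > 0" by (simp add: t_def)
  have shift: "weyl_dist (F z) (suffix t (F z)) = 0" for z
  proof -
    obtain x y n where xy: "n \<le> \<theta>" "suffix n x = z" "suffix n y = z"
      and "image_length \<theta> f x n \<noteq> image_length \<theta> f y n"
      using image_length_neqE[OF nonunif diameter_pos] by metis
    moreover have "weyl_dist x y = 0" "weyl_dist y x = 0"
      using xy by (simp_all add: weyl_dist_eq_0_if_suffix_eq[of n])
    \<comment> \<open>By symmetry the words may be swapped, so that \<open>x\<close> has the longer
      image.\<close>
    ultimately obtain x y where xy: "suffix n x = z" "suffix n y = z" "weyl_dist x y = 0"
      and less: "image_length \<theta> f y n < image_length \<theta> f x n"
      by (metis linorder_neqE_nat)
    let ?p = "image_length \<theta> f x n" and ?q = "image_length \<theta> f y n"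
    define s where "s = ?p - ?q"
    have "suffix ?p (F x) = F z" using xy by (simp add: suffix_dill_map)
    \<comment> \<open>In \<open>F y\<close> the copy of \<open>F z\<close> starts at
      \<open>?q\<close>, so at position \<open>?p\<close> it is already \<open>s\<close> letters
      advanced.\<close>
    moreover have "suffix ?p (F y) = suffix s (F z)"
    proof -
      have "suffix ?p (F y) = suffix s (suffix ?q (F y))" using less by (simp add: s_def)
      then show ?thesis using xy by (simp only: suffix_dill_map)
    qed
    ultimately have "weyl_dist (F z) (suffix s (F z)) \<le> weyl_dist (F x) (F y)"
      using weyl_dist_suffix_le[of ?p "F x" "F y"] by simp
    then have "weyl_dist (F z) (suffix s (F z)) = 0"
      using comp[OF xy(3)] weyl_dist_nonneg[of "F z" "suffix s (F z)"] by simp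
    moreover have "s dvd t" unfolding t_def
    proof (rule dvd_fact)
      show "1 \<le> s" using less by (simp add: s_def)
      have "s \<le> n * upper_norm \<theta> f"
        using image_length_le[of \<theta> f x n] by (simp add: s_def)
      also have "\<dots> \<le> \<theta> * upper_norm \<theta> f" using \<open>n \<le> \<theta>\<close> by simp
      finally show "s \<le> \<theta> * upper_norm \<theta> f" .
    qed
    ultimately show ?thesis
      using weyl_dist_suffix_mult by (metis dvd_def mult.commute)
  qed
  have period: "suffix t (F z) = F z" for z
  proof
    fix j
    \<comment> \<open>The periodic word \<open>x\<close> agrees with \<open>z\<close> on as many
      letters as determine the image up to position \<open>j + t\<close>.\<close>
    define n where "n = j + t + \<theta>"
    define x where "x = (\<lambda>i. z (i mod n))"
    define p where "p = image_length \<theta> f x n"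
    have "n > 0" using diameter_pos by (simp add: n_def)
    then have "p > 0" using image_length_ge[of n x] by (simp add: p_def)
    have "suffix n x = x" by (simp add: x_def suffix_def)
    then have p: "suffix p (F x) = F x" by (simp add: p_def suffix_dill_map)
    moreover have "suffix p (suffix t (F x)) = suffix t (F x)"
    proof -
      have "suffix p (suffix t (F x)) = suffix t (suffix p (F x))" by (simp add: add.commute)
      then show ?thesis by (simp only: p)
    qed
    \<comment> \<open>Both words have period \<open>p\<close>, so Weyl equivalence becomes
      equality.\<close>
    ultimately have "F x = suffix t (F x)"
      using \<open>p > 0\<close> shift by (rule periodic_eq_if_weyl_dist_eq_0)
    then have "F x (t + j) = F x j" by (metis suffix_nth)
    moreover have "F x i = F z i" if "i \<le> j + t" for i
      using that by (rule dill_map_cong[rotated]) (simp add: x_def n_def)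
    ultimately show "suffix t (F z) j = F z j" by simp
  qed
  \<comment> \<open>A hybrid: its prefix fixes the first \<open>t\<close> letters of
    \<open>F x\<close>, hence by periodicity all of \<open>F x\<close>, while its tail makes it Weyl
    equivalent to \<open>y\<close>.\<close>
  define w where "w = (\<lambda>i. if i < t + \<theta> then x i else y i)"
  have "suffix (t + \<theta>) w = suffix (t + \<theta>) y" by (auto simp: w_def suffix_def)
  then have "weyl_dist (F w) (F y) = 0"
    by (intro comp weyl_dist_eq_0_if_suffix_eq)
  with period period \<open>t > 0\<close> have "F w = F y" by (rule periodic_eq_if_weyl_dist_eq_0)
  moreover have "F x = F w"
  proof
    fix j
    \<comment> \<open>Reduction to positions below \<open>t\<close>, where only the common prefix of
      \<open>x\<close> and \<open>w\<close> matters.\<close>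
    have red: "F z j = F z (j mod t)" for z
      using fun_cong[OF suffix_period_mult[OF period, of "j div t" z], of "j mod t"] by simp
    have "F x (j mod t) = F w (j mod t)"
      by (rule dill_map_cong[of t]) (use \<open>t > 0\<close> in \<open>simp_all add: w_def less_imp_le\<close>)
    then show "F x j = F w j" by (simp only: red[of x] red[of w])
  qed
  ultimately show ?thesis by simp
qed

end

theorem theorem2:
  fixes f :: "'a::finite list \<Rightarrow> 'a list" and F :: "'a word \<Rightarrow> 'a word" and \<theta> :: nat
  assumes "dill_map \<theta> f F"
  shows "((\<forall>x y. weyl_dist x y = 0 \<longrightarrow> weyl_dist (F x) (F y) = 0) \<longleftrightarrow>
          (\<forall>x y. weyl_dist (F x) (F y)
                 \<le> real \<theta> * real (max_hamming \<theta> f) / real (lower_norm \<theta> f) * weyl_dist x y))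
       \<and> ((\<forall>x y. weyl_dist (F x) (F y)
                 \<le> real \<theta> * real (max_hamming \<theta> f) / real (lower_norm \<theta> f) * weyl_dist x y) \<longleftrightarrow>
          ((\<forall>x y. F x = F y) \<or> uniform_rule \<theta> f))"
    (is "(?compatible \<longleftrightarrow> ?lipschitz) \<and> (?lipschitz \<longleftrightarrow> ?constant \<or> ?uniform)")
proof -
  \<comment> \<open>The conditions are linked in a cycle. At distance 0 the Lipschitz bound vanishes
    whatever its constant.\<close>
  have "?lipschitz \<Longrightarrow> ?compatible"
  proof (intro allI impI)
    fix x y :: "'a word"
    assume "?lipschitz" and "weyl_dist x y = 0"
    then have "weyl_dist (F x) (F y) \<le> 0" by (metis mult_zero_right)
    then show "weyl_dist (F x) (F y) = 0" using weyl_dist_nonneg by (rule order_antisym)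
  qed
  moreover have "?compatible \<Longrightarrow> ?constant \<or> ?uniform"
    using weyl_compatible_imp_constant[OF assms] by metis
  moreover have "?constant \<Longrightarrow> ?lipschitz"
  proof (intro allI)
    fix x y
    assume "?constant"
    then have "F x = F y" by blast
    then have "weyl_dist (F x) (F y) = 0"
      by (simp add: weyl_dist_eq_0_if_suffix_eq[of 0])
    then show "weyl_dist (F x) (F y)
        \<le> real \<theta> * real (max_hamming \<theta> f) / real (lower_norm \<theta> f) * weyl_dist x y"
      by (simp add: weyl_dist_nonneg)
  qed
  moreover have "?uniform \<Longrightarrow> ?lipschitz"
    using uniform_imp_lipschitz[OF assms] by blast
  ultimately show ?thesis by blast
qed

end
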